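(* Let $((\Omega,\mathcal H),\mathfrak N,((X,\eta_1),(Y,\eta_2),(Z,\eta_3);\bullet))$ be a partially ordered integration structure (so $X,Y,Z$ are Riesz spaces), let $\mu:\mathcal H\to Y$ be a set function, and let $L_{NR}(\mu)$ be the set of functions $f:\Omega\to X$ that are net Riemann integrable with respect to $\mu$ on every $A\in\mathcal H$. Then: (i) If $f\in L_{NR}(\mu)$, $f\ge 0$ and $\mu\ge 0$, then $\int_A f\,d\mu\ge 0$ for each $A\in\mathcal H$. (ii) If $\mu\ge 0$ and $f,g\in L_{NR}(\mu)$ satisfy $g\ge f$ (pointwise), then $\int_A g\,d\mu\ge\int_A f\,d\mu$ for each $A\in\mathcal H$. (iii) If $\mu\ge 0$ and $f\in L_{NR}(\mu)$ is such that $|f|\in L_{NR}(\mu)$, where $|f|(\omega)=|f(\omega)|$, then $\left|\int_A f\,d\mu\right|\le\int_A|f|\,d\mu$ for each $A\in\mathcal H$.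
   Context: A net convergence structure $\eta$ on a set $V$ assigns to each $v\in V$ a class $\eta(v)$ of nets in $V$ (those "converging to $v$") such that: (i) constant nets equal to $v$ converge to $v$; (ii) every quasi-subnet of a net converging to $v$ converges to $v$, where $(y_j)_{j\in J}$ is a quasi-subnet of $(x_i)_{i\in I}$ if for every $i_0\in I$ there is $j_0\in J$ with $\{y_j:j\ge j_0\}\subseteq\{x_i:i\ge i_0\}$; (iii) if $(x_i)_{i\in I}$ and $(y_i)_{i\in I}$ converge to $v$ and $z_i\in\{x_i,y_i\}$ for all $i$, then $(z_i)$ converges to $v$. A map is continuous if it sends nets converging to $v$ to nets converging to the image of $v$; products carry coordinatewise convergence. Standing assumptions: vector spaces are real; all net convergence structures are Hausdorff (limits are unique); on a vector space, addition and multiplication by each fixed real number are continuous. Riesz spaces are Archimedean, and a net convergence structure on a Riesz space is assumed locally solid: if $(y_l)_{l\in L}$ converges to $0$ and $(x_i)_{i\in I}$ is a net such that for every $l_0\in L$ there is $i_0\in I$ such that for every $i\ge i_0$ there is $l\ge l_0$ with $|x_i|\le|y_l|$, then $(x_i)$ converges to $0$ (in particular if $|x_i|\le |y_i|$ for all $i$ with the same index set). A bilinear product is a bilinear map $\bullet:X\times Y\to Z$ (written by juxtaposition) such that $x\mapsto x\bullet y$ and $y\mapsto x\bullet y$ are continuous; for Riesz spaces it is also isotone on $X^+\times Y^+$, and $\sup_n(x_n\bullet y)=(\sup_n x_n)\bullet y$, $\sup_n(x\bullet y_n)=x\bullet(\sup_n y_n)$ for $x\in X^+$, $y\in Y^+$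 and nonnegative sequences whose suprema exist. A paved space $(\Omega,\mathcal H)$ is a nonempty set $\Omega$ with a collection $\mathcal H$ of subsets with $\emptyset\in\mathcal H$. For each $A\in\mathcal H$ a Fleischer–Szabó–Száz net $\mathfrak N_A=\{(\sigma_\gamma,\tau_\gamma)\}_{\gamma\in\Gamma_A}$ is given: $\Gamma_A$ is a directed set and $\sigma_\gamma=\{\sigma_{\gamma_i}\}_{i\in I_\gamma}$, $\tau_\gamma=\{\tau_{\gamma_i}\}_{i\in I_\gamma}$ are finite families in $\mathcal H$ and $\Omega$ respectively. An integration structure consists of $(\Omega,\mathcal H)$, these nets $\mathfrak N$, and vector spaces with net convergence structures connected by a bilinear product $\bullet:X\times Y\to Z$; it is partially ordered if $X,Y,Z$ are Riesz spaces. For $f:\Omega\to X$, $\mu:\mathcal H\to Y$ put $S^A_\gamma(f,\mu)=\sum_{i\in I_\gamma}f(\tau_{\gamma_i})\mu(\sigma_{\gamma_i})$. $f$ is net Riemann integrable on $A$ if $\int_A f\,d\mu:=\lim_{\gamma\in\Gamma_A}S^A_\gamma(f,\mu)$ exists in $(Z,\eta_3)$. *)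

theory Defs
  imports
    "HOL-Analysis.Analysis"
    "HOL-Library.Lattice_Algebras"
    "HOL-Library.Lub_Glb"
begin

section \<open>Nets and net convergence structures\<close>

text \<open>
  A net in \<open>'v\<close> carries its own directed index set, a subset of the type \<open>'i\<close>.
  The proper class of all nets cannot be a HOL object; a net convergence structure is
  therefore given on the nets whose index set lives in \<open>'i\<close>.  As \<open>'i\<close> is a type variable, a
  theorem about such structures applies to the restriction of a class-sized structure to any
  index universe, in particular to one that contains all the directed sets of interest.
  The values of \<open>val\<close> outside the index set are irrelevant: two nets that differ only there are
  quasi-subnets of each other.
\<close>

record ('i, 'v) net =
  idx :: "'i set"
  le :: "'i rel"
  val :: "'i \<Rightarrow> 'v"

definition directed_set :: "'i set \<Rightarrow> 'i rel \<Rightarrow> bool" where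
  "directed_set I r \<longleftrightarrow> I \<noteq> {} \<and> preorder_on I r \<and>
     (\<forall>i\<in>I. \<forall>j\<in>I. \<exists>k\<in>I. (i, k) \<in> r \<and> (j, k) \<in> r)"

definition is_net :: "('i, 'v) net \<Rightarrow> bool" where
  "is_net N \<longleftrightarrow> directed_set (idx N) (le N)"

definition up :: "('i, 'v) net \<Rightarrow> 'i \<Rightarrow> 'i set" where
  "up N i = {j \<in> idx N. (i, j) \<in> le N}"

definition quasi_subnet :: "('i, 'v) net \<Rightarrow> ('i, 'v) net \<Rightarrow> bool" where
  "quasi_subnet M N \<longleftrightarrow> (\<forall>i0\<in>idx N. \<exists>j0\<in>idx M. val M ` up M j0 \<subseteq> val N ` up N i0)"

definition same_index :: "('i, 'v) net \<Rightarrow> ('i, 'w) net \<Rightarrow> bool" where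
  "same_index M N \<longleftrightarrow> idx M = idx N \<and> le M = le N"

definition net_map :: "('v \<Rightarrow> 'w) \<Rightarrow> ('i, 'v) net \<Rightarrow> ('i, 'w) net" where
  "net_map h N = \<lparr>idx = idx N, le = le N, val = h \<circ> val N\<rparr>"

text \<open>\<open>N \<in> \<eta> v\<close> means that the net \<open>N\<close> converges to \<open>v\<close>.\<close>

type_synonym ('i, 'v) net_conv = "'v \<Rightarrow> ('i, 'v) net set"

locale net_convergence_structure =
  fixes \<eta> :: "('i, 'v) net_conv"
  assumes nets: "N \<in> \<eta> v \<Longrightarrow> is_net N"
    and constant_nets: "is_net N \<Longrightarrow> \<forall>i\<in>idx N. val N i = v \<Longrightarrow> N \<in> \<eta> v"
    and quasi_subnets: "N \<in> \<eta> v \<Longrightarrow> is_net M \<Longrightarrow> quasi_subnet M N \<Longrightarrow> M \<in> \<eta> v"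
    and mixing: "M \<in> \<eta> v \<Longrightarrow> N \<in> \<eta> v \<Longrightarrow> same_index M N \<Longrightarrow> same_index L M \<Longrightarrow>
      \<forall>i\<in>idx L. val L i \<in> {val M i, val N i} \<Longrightarrow> L \<in> \<eta> v"

locale hausdorff_net_convergence_structure = net_convergence_structure +
  assumes hausdorff: "N \<in> \<eta> u \<Longrightarrow> N \<in> \<eta> v \<Longrightarrow> u = v"

definition net_continuous ::
    "('i, 'v) net_conv \<Rightarrow> ('i, 'w) net_conv \<Rightarrow> ('v \<Rightarrow> 'w) \<Rightarrow> bool" where
  "net_continuous \<eta> \<theta> h \<longleftrightarrow> (\<forall>v. \<forall>N\<in>\<eta> v. net_map h N \<in> \<theta> (h v))"

definition prod_conv ::
    "('i, 'v) net_conv \<Rightarrow> ('i, 'w) net_conv \<Rightarrow> ('i, 'v \<times> 'w) net_conv" where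
  "prod_conv \<eta> \<theta> = (\<lambda>(v, w). {N. net_map fst N \<in> \<eta> v \<and> net_map snd N \<in> \<theta> w})"

definition net_lim :: "('i, 'v) net_conv \<Rightarrow> ('i, 'v) net \<Rightarrow> 'v" where
  "net_lim \<eta> N = (THE v. N \<in> \<eta> v)"

locale convergence_vector_space = hausdorff_net_convergence_structure \<eta>
  for \<eta> :: "('i, 'v::real_vector) net_conv" +
  assumes add_continuous: "net_continuous (prod_conv \<eta> \<eta>) \<eta> (\<lambda>(u, v). u + v)"
    and scaleR_continuous: "net_continuous \<eta> \<eta> (\<lambda>v. c *\<^sub>R v)"


section \<open>Archimedean Riesz spaces and bilinear products\<close>

class archimedean_riesz_space = ordered_real_vector + lattice_ab_group_add_abs +
  assumes archimedean: "0 \<le> x \<Longrightarrow> (\<forall>n::nat. real n *\<^sub>R x \<le> y) \<Longrightarrow> x = 0"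

locale convergence_riesz_space = convergence_vector_space \<eta>
  for \<eta> :: "('i, 'v::archimedean_riesz_space) net_conv" +
  assumes locally_solid: "N \<in> \<eta> 0 \<Longrightarrow> is_net M \<Longrightarrow>
      \<forall>l0\<in>idx N. \<exists>i0\<in>idx M. \<forall>i\<in>up M i0. \<exists>l\<in>up N l0. \<bar>val M i\<bar> \<le> \<bar>val N l\<bar> \<Longrightarrow>
      M \<in> \<eta> 0"

locale bilinear_product =
  fixes \<eta>1 :: "('i, 'x::real_vector) net_conv"
    and \<eta>2 :: "('i, 'y::real_vector) net_conv"
    and \<eta>3 :: "('i, 'z::real_vector) net_conv"
    and pr :: "'x \<Rightarrow> 'y \<Rightarrow> 'z"
  assumes bilinear: "bilinear pr"
    and continuous_left: "net_continuous \<eta>1 \<eta>3 (\<lambda>x. pr x y)"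
    and continuous_right: "net_continuous \<eta>2 \<eta>3 (\<lambda>y. pr x y)"

text \<open>Suprema need not exist in a Riesz space, so \<open>sup\<^sub>n s\<^sub>n = s\<close> is expressed by
  \<open>isLub UNIV (range s) s\<close>; the conclusions below include that the supremum exists.\<close>

locale riesz_bilinear_product = bilinear_product \<eta>1 \<eta>2 \<eta>3 pr
  for \<eta>1 :: "('i, 'x::archimedean_riesz_space) net_conv"
    and \<eta>2 :: "('i, 'y::archimedean_riesz_space) net_conv"
    and \<eta>3 :: "('i, 'z::archimedean_riesz_space) net_conv"
    and pr :: "'x \<Rightarrow> 'y \<Rightarrow> 'z" +
  assumes isotone: "0 \<le> x \<Longrightarrow> x \<le> x' \<Longrightarrow> 0 \<le> y \<Longrightarrow> y \<le> y' \<Longrightarrow> pr x y \<le> pr x' y'"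
    and sup_left: "\<And>xs s y. \<forall>n::nat. 0 \<le> xs n \<Longrightarrow> isLub UNIV (range xs) s \<Longrightarrow> 0 \<le> y \<Longrightarrow>
      isLub UNIV (range (\<lambda>n. pr (xs n) y)) (pr s y)"
    and sup_right: "\<And>x ys s. \<forall>n::nat. 0 \<le> ys n \<Longrightarrow> isLub UNIV (range ys) s \<Longrightarrow> 0 \<le> x \<Longrightarrow>
      isLub UNIV (range (\<lambda>n. pr x (ys n))) (pr x s)"


section \<open>Integration structures\<close>

locale paved_space =
  fixes \<Omega> :: "'w set" and \<H> :: "'w set set"
  assumes nonempty: "\<Omega> \<noteq> {}"
    and paving: "\<H> \<subseteq> Pow \<Omega>"
    and empty_mem: "{} \<in> \<H>"

text \<open>A pair \<open>(\<sigma>\<^sub>\<gamma>, \<tau>\<^sub>\<gamma>)\<close> of families with the common index set \<open>I\<^sub>\<gamma>\<close> (the field \<open>fam\<close>).\<close>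

record ('k, 'w) tagged_family =
  fam :: "'k set"
  sets_of :: "'k \<Rightarrow> 'w set"
  tags_of :: "'k \<Rightarrow> 'w"

definition fst_net ::
    "'w set \<Rightarrow> 'w set set \<Rightarrow> ('i, ('k, 'w) tagged_family) net \<Rightarrow> bool" where
  "fst_net \<Omega> \<H> N \<longleftrightarrow> is_net N \<and>
     (\<forall>\<gamma>\<in>idx N. finite (fam (val N \<gamma>)) \<and>
        (\<forall>i\<in>fam (val N \<gamma>). sets_of (val N \<gamma>) i \<in> \<H> \<and> tags_of (val N \<gamma>) i \<in> \<Omega>))"

locale integration_structure =
  paved_space \<Omega> \<H> +
  X: convergence_vector_space \<eta>1 +
  Y: convergence_vector_space \<eta>2 +
  Z: convergence_vector_space \<eta>3 +
  bilinear_product \<eta>1 \<eta>2 \<eta>3 pr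
  for \<Omega> :: "'w set" and \<H> :: "'w set set"
    and \<NN> :: "'w set \<Rightarrow> ('i, ('k, 'w) tagged_family) net"
    and \<eta>1 :: "('i, 'x::real_vector) net_conv"
    and \<eta>2 :: "('i, 'y::real_vector) net_conv"
    and \<eta>3 :: "('i, 'z::real_vector) net_conv"
    and pr :: "'x \<Rightarrow> 'y \<Rightarrow> 'z" +
  assumes fst_nets: "A \<in> \<H> \<Longrightarrow> fst_net \<Omega> \<H> (\<NN> A)"

locale partially_ordered_integration_structure =
  integration_structure \<Omega> \<H> \<NN> \<eta>1 \<eta>2 \<eta>3 pr +
  X: convergence_riesz_space \<eta>1 +
  Y: convergence_riesz_space \<eta>2 +
  Z: convergence_riesz_space \<eta>3 +
  riesz_bilinear_product \<eta>1 \<eta>2 \<eta>3 pr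
  for \<Omega> :: "'w set" and \<H> :: "'w set set"
    and \<NN> :: "'w set \<Rightarrow> ('i, ('k, 'w) tagged_family) net"
    and \<eta>1 :: "('i, 'x::archimedean_riesz_space) net_conv"
    and \<eta>2 :: "('i, 'y::archimedean_riesz_space) net_conv"
    and \<eta>3 :: "('i, 'z::archimedean_riesz_space) net_conv"
    and pr :: "'x \<Rightarrow> 'y \<Rightarrow> 'z"


section \<open>The net Riemann integral\<close>

text \<open>Functions on \<open>\<Omega>\<close> and set functions on \<open>\<H>\<close> are total functions of which only the values
  on \<open>\<Omega>\<close> and on \<open>\<H>\<close> matter.\<close>

definition riemann_sum ::
    "('x \<Rightarrow> 'y \<Rightarrow> 'z::real_vector) \<Rightarrow> ('w \<Rightarrow> 'x) \<Rightarrow> ('w set \<Rightarrow> 'y) \<Rightarrow> ('k, 'w) tagged_family \<Rightarrow> 'z"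
  where
  "riemann_sum pr f \<mu> P = (\<Sum>i\<in>fam P. pr (f (tags_of P i)) (\<mu> (sets_of P i)))"

definition sum_net ::
    "('w set \<Rightarrow> ('i, ('k, 'w) tagged_family) net) \<Rightarrow> ('x \<Rightarrow> 'y \<Rightarrow> 'z::real_vector) \<Rightarrow>
     ('w \<Rightarrow> 'x) \<Rightarrow> ('w set \<Rightarrow> 'y) \<Rightarrow> 'w set \<Rightarrow> ('i, 'z) net" where
  "sum_net \<NN> pr f \<mu> A = net_map (riemann_sum pr f \<mu>) (\<NN> A)"

definition net_riemann_integrable ::
    "('w set \<Rightarrow> ('i, ('k, 'w) tagged_family) net) \<Rightarrow> ('i, 'z::real_vector) net_conv \<Rightarrow>
     ('x \<Rightarrow> 'y \<Rightarrow> 'z) \<Rightarrow> ('w set \<Rightarrow> 'y) \<Rightarrow> ('w \<Rightarrow> 'x) \<Rightarrow> 'w set \<Rightarrow> bool" where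
  "net_riemann_integrable \<NN> \<eta>3 pr \<mu> f A \<longleftrightarrow> (\<exists>z. sum_net \<NN> pr f \<mu> A \<in> \<eta>3 z)"

definition net_riemann_integral ::
    "('w set \<Rightarrow> ('i, ('k, 'w) tagged_family) net) \<Rightarrow> ('i, 'z::real_vector) net_conv \<Rightarrow>
     ('x \<Rightarrow> 'y \<Rightarrow> 'z) \<Rightarrow> ('w set \<Rightarrow> 'y) \<Rightarrow> ('w \<Rightarrow> 'x) \<Rightarrow> 'w set \<Rightarrow> 'z" where
  "net_riemann_integral \<NN> \<eta>3 pr \<mu> f A = net_lim \<eta>3 (sum_net \<NN> pr f \<mu> A)"

definition L_NR ::
    "'w set set \<Rightarrow> ('w set \<Rightarrow> ('i, ('k, 'w) tagged_family) net) \<Rightarrow>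
     ('i, 'z::real_vector) net_conv \<Rightarrow> ('x \<Rightarrow> 'y \<Rightarrow> 'z) \<Rightarrow> ('w set \<Rightarrow> 'y) \<Rightarrow> ('w \<Rightarrow> 'x) set" where
  "L_NR \<H> \<NN> \<eta>3 pr \<mu> = {f. \<forall>A\<in>\<H>. net_riemann_integrable \<NN> \<eta>3 pr \<mu> f A}"

end

theory Submission
  imports Defs
begin

text \<open>
  Everything follows from the fact that limits preserve order (\<open>limit_mono\<close>), which in turn rests
  on the closedness of the positive cone (\<open>limit_nonneg\<close>).  The cone is closed for the following
  reason: if the net \<open>x\<^sub>i \<ge> 0\<close> converges to \<open>z\<close>, then \<open>x\<^sub>i - z\<close> converges to \<open>0\<close> and dominates
  the negative part of the limit, \<open>0 \<le> z\<^sup>- \<le> \<bar>x\<^sub>i - z\<bar>\<close>.  By local solidness the constant net \<open>z\<^sup>-\<close>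
  converges to \<open>0\<close>, and as it also converges to \<open>z\<^sup>-\<close>, uniqueness of limits gives \<open>z\<^sup>- = 0\<close>.

  The Riemann sums are monotone in \<open>f\<close> when \<open>\<mu> \<ge> 0\<close>, because every tag lies in \<open>\<Omega>\<close>, every set
  lies in \<open>\<H>\<close>, and the product of nonnegative elements is nonnegative.  Passing to the limit
  along the index set of \<open>\<NN> A\<close> gives monotonicity of the integral.  Nonnegativity is comparison
  with the function \<open>0\<close>, and the inequality for absolute values is comparison of \<open>\<bar>f\<bar>\<close> with both
  \<open>f\<close> and \<open>-f\<close>, the integral being compatible with \<open>-\<close>.
\<close>

lemma (in hausdorff_net_convergence_structure) net_lim_eq:
  assumes "N \<in> \<eta> v"
  shows "net_lim \<eta> N = v"
  unfolding net_lim_def using assms hausdorff by blast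

lemma (in convergence_vector_space) net_map_uminus_converges:
  assumes "N \<in> \<eta> v"
  shows "net_map uminus N \<in> \<eta> (- v)"
  using scaleR_continuous[of "- 1"] assms by (auto simp: net_continuous_def)

text \<open>Two nets can be added only along a common index set: joint continuity of addition speaks
  about a single net of pairs.\<close>

lemma (in convergence_vector_space) diff_converges:
  assumes M: "M \<in> \<eta> u" and N: "N \<in> \<eta> v" and same: "same_index M N"
  shows "\<lparr>idx = idx N, le = le N, val = \<lambda>i. val N i - val M i\<rparr> \<in> \<eta> (v - u)"
proof -
  let ?P = "\<lparr>idx = idx N, le = le N, val = \<lambda>i. (val N i, - val M i)\<rparr>"
  have "net_map fst ?P = N" "net_map snd ?P = net_map uminus M"
    using same by (simp_all add: net_map_def same_index_def comp_def)
  then have "?P \<in> prod_conv \<eta> \<eta> (v, - u)"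
    using N net_map_uminus_converges[OF M] by (simp add: prod_conv_def)
  then have "net_map (\<lambda>(a, b). a + b) ?P \<in> \<eta> (v + - u)"
    using add_continuous unfolding net_continuous_def by fastforce
  then show ?thesis by (simp add: net_map_def comp_def)
qed

text \<open>The positive cone of a locally solid Hausdorff structure is closed under limits: the
  deviations \<open>\<bar>x\<^sub>i - z\<bar>\<close> dominate the negative part of \<open>z\<close>, here written \<open>pprt (- z)\<close>.\<close>

lemma (in convergence_riesz_space) limit_nonneg:
  assumes N: "N \<in> \<eta> z" and nonneg: "\<forall>i\<in>idx N. 0 \<le> val N i"
  shows "0 \<le> z"
proof -
  define C :: "'v \<Rightarrow> ('i, 'v) net" where "C = (\<lambda>v. \<lparr>idx = idx N, le = le N, val = \<lambda>_. v\<rparr>)"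
  define D where "D = \<lparr>idx = idx N, le = le N, val = \<lambda>i. val N i - z\<rparr>"
  have C_net: "is_net (C v)" for v
    using nets[OF N] by (simp add: C_def is_net_def)
  have C_conv: "C v \<in> \<eta> v" for v
    by (rule constant_nets[OF C_net]) (simp add: C_def)
  have D_conv: "D \<in> \<eta> 0"
    using diff_converges[OF C_conv[of z] N] by (simp add: C_def D_def same_index_def)
  have dominated: "\<bar>pprt (- z)\<bar> \<le> \<bar>val D i\<bar>" if "i \<in> idx N" for i
  proof -
    have "- z \<le> val N i - z"
      using nonneg that by simp
    also have "\<dots> \<le> \<bar>val N i - z\<bar>"
      by (rule abs_ge_self)
    finally have "pprt (- z) \<le> \<bar>val N i - z\<bar>"
      by (simp add: pprt_def)
    then show ?thesis by (simp add: D_def)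
  qed
  have "C (pprt (- z)) \<in> \<eta> 0"
  proof (rule locally_solid[OF D_conv C_net], intro ballI)
    fix l0 assume l0: "l0 \<in> idx D"
    show "\<exists>i0\<in>idx (C (pprt (- z))). \<forall>i\<in>up (C (pprt (- z))) i0. \<exists>l\<in>up D l0.
        \<bar>val (C (pprt (- z))) i\<bar> \<le> \<bar>val D l\<bar>"
      using l0 dominated by (intro bexI[of _ l0]) (auto simp: C_def D_def up_def)
  qed
  then have "pprt (- z) = 0"
    using hausdorff C_conv by blast
  then show ?thesis
    by (metis neg_le_0_iff_le le_iff_sup pprt_def sup.commute)
qed

lemma (in convergence_riesz_space) limit_mono:
  assumes "M \<in> \<eta> u" and "N \<in> \<eta> v" and "same_index M N"
    and "\<forall>i\<in>idx N. val M i \<le> val N i"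
  shows "u \<le> v"
  using limit_nonneg[OF diff_converges[OF assms(1-3)]] assms(4) by simp

text \<open>Isotony is only given on positive cones, so monotonicity of \<open>x \<mapsto> x \<bullet> y\<close> for arbitrary
  \<open>x \<le> x'\<close> is obtained from \<open>(x' - x) \<bullet> y \<ge> 0\<close>.\<close>

lemma (in riesz_bilinear_product) product_mono_left:
  assumes "x \<le> x'" and "0 \<le> y"
  shows "pr x y \<le> pr x' y"
proof -
  have "pr 0 0 \<le> pr (x' - x) y"
    using assms by (intro isotone) auto
  then show ?thesis
    by (simp add: bilinear_lzero[OF bilinear] bilinear_lsub[OF bilinear])
qed

context partially_ordered_integration_structure
begin

lemma riemann_sum_mono:
  assumes "\<forall>B\<in>\<H>. 0 \<le> \<mu> B" and "\<forall>\<omega>\<in>\<Omega>. f \<omega> \<le> g \<omega>"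
    and "A \<in> \<H>" and "\<gamma> \<in> idx (\<NN> A)"
  shows "riemann_sum pr f \<mu> (val (\<NN> A) \<gamma>) \<le> riemann_sum pr g \<mu> (val (\<NN> A) \<gamma>)"
  unfolding riemann_sum_def
  using assms fst_nets[OF assms(3)]
  by (intro sum_mono product_mono_left) (auto simp: fst_net_def)

text \<open>Stated for arbitrary limits of the sums, so that it applies to \<open>0\<close> and \<open>-f\<close> as soon as
  their sums are known to converge.\<close>

lemma sum_net_limit_mono:
  assumes "\<forall>B\<in>\<H>. 0 \<le> \<mu> B" and "\<forall>\<omega>\<in>\<Omega>. f \<omega> \<le> g \<omega>" and "A \<in> \<H>"
    and "sum_net \<NN> pr f \<mu> A \<in> \<eta>3 u" and "sum_net \<NN> pr g \<mu> A \<in> \<eta>3 v"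
  shows "u \<le> v"
  using assms(4,5)
proof (rule Z.limit_mono)
  show "same_index (sum_net \<NN> pr f \<mu> A) (sum_net \<NN> pr g \<mu> A)"
    by (simp add: same_index_def sum_net_def net_map_def)
  show "\<forall>\<gamma>\<in>idx (sum_net \<NN> pr g \<mu> A). val (sum_net \<NN> pr f \<mu> A) \<gamma> \<le> val (sum_net \<NN> pr g \<mu> A) \<gamma>"
    using riemann_sum_mono[OF assms(1-3)] by (simp add: sum_net_def net_map_def)
qed

lemma sum_net_zero:
  assumes "A \<in> \<H>"
  shows "sum_net \<NN> pr (\<lambda>_. 0) \<mu> A \<in> \<eta>3 0"
  using fst_nets[OF assms]
  by (intro Z.constant_nets)
    (simp_all add: sum_net_def net_map_def riemann_sum_def bilinear_lzero[OF bilinear]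
      fst_net_def is_net_def)

lemma sum_net_uminus:
  assumes "sum_net \<NN> pr f \<mu> A \<in> \<eta>3 z"
  shows "sum_net \<NN> pr (\<lambda>\<omega>. - f \<omega>) \<mu> A \<in> \<eta>3 (- z)"
proof -
  have "sum_net \<NN> pr (\<lambda>\<omega>. - f \<omega>) \<mu> A = net_map uminus (sum_net \<NN> pr f \<mu> A)"
    by (simp add: sum_net_def net_map_def riemann_sum_def comp_def
        bilinear_lneg[OF bilinear] sum_negf)
  then show ?thesis
    using Z.net_map_uminus_converges[OF assms] by simp
qed

lemma sum_net_converges_to_integral:
  assumes "f \<in> L_NR \<H> \<NN> \<eta>3 pr \<mu>" and "A \<in> \<H>"
  shows "sum_net \<NN> pr f \<mu> A \<in> \<eta>3 (net_riemann_integral \<NN> \<eta>3 pr \<mu> f A)"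
proof -
  obtain z where "sum_net \<NN> pr f \<mu> A \<in> \<eta>3 z"
    using assms by (auto simp: L_NR_def net_riemann_integrable_def)
  then show ?thesis
    by (simp add: net_riemann_integral_def Z.net_lim_eq)
qed

lemma integral_nonneg:
  assumes "f \<in> L_NR \<H> \<NN> \<eta>3 pr \<mu>" and "\<forall>\<omega>\<in>\<Omega>. 0 \<le> f \<omega>"
    and "\<forall>B\<in>\<H>. 0 \<le> \<mu> B" and "A \<in> \<H>"
  shows "0 \<le> net_riemann_integral \<NN> \<eta>3 pr \<mu> f A"
  by (rule sum_net_limit_mono[OF assms(3,2,4) sum_net_zero[OF assms(4)]
        sum_net_converges_to_integral[OF assms(1,4)]])

lemma integral_mono:
  assumes "f \<in> L_NR \<H> \<NN> \<eta>3 pr \<mu>" and "g \<in> L_NR \<H> \<NN> \<eta>3 pr \<mu>"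
    and "\<forall>\<omega>\<in>\<Omega>. f \<omega> \<le> g \<omega>" and "\<forall>B\<in>\<H>. 0 \<le> \<mu> B" and "A \<in> \<H>"
  shows "net_riemann_integral \<NN> \<eta>3 pr \<mu> f A \<le> net_riemann_integral \<NN> \<eta>3 pr \<mu> g A"
  by (rule sum_net_limit_mono[OF assms(4,3,5) sum_net_converges_to_integral[OF assms(1,5)]
        sum_net_converges_to_integral[OF assms(2,5)]])

lemma abs_integral_le:
  assumes "f \<in> L_NR \<H> \<NN> \<eta>3 pr \<mu>" and "(\<lambda>\<omega>. \<bar>f \<omega>\<bar>) \<in> L_NR \<H> \<NN> \<eta>3 pr \<mu>"
    and "\<forall>B\<in>\<H>. 0 \<le> \<mu> B" and "A \<in> \<H>"
  shows "\<bar>net_riemann_integral \<NN> \<eta>3 pr \<mu> f A\<bar> \<le> net_riemann_integral \<NN> \<eta>3 pr \<mu> (\<lambda>\<omega>. \<bar>f \<omega>\<bar>) A"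
proof (rule abs_leI)
  show "net_riemann_integral \<NN> \<eta>3 pr \<mu> f A \<le> net_riemann_integral \<NN> \<eta>3 pr \<mu> (\<lambda>\<omega>. \<bar>f \<omega>\<bar>) A"
    by (rule integral_mono[OF assms(1,2) _ assms(3,4)]) (simp add: abs_ge_self)
  show "- net_riemann_integral \<NN> \<eta>3 pr \<mu> f A \<le> net_riemann_integral \<NN> \<eta>3 pr \<mu> (\<lambda>\<omega>. \<bar>f \<omega>\<bar>) A"
    by (rule sum_net_limit_mono[OF assms(3) _ assms(4)
          sum_net_uminus[OF sum_net_converges_to_integral[OF assms(1,4)]]
          sum_net_converges_to_integral[OF assms(2,4)]]) (simp add: abs_ge_minus_self)
qed

end

theorem theorem2p3:
  fixes \<Omega> :: "'w set" and \<H> :: "'w set set"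
    and \<NN> :: "'w set \<Rightarrow> ('i, ('k, 'w) tagged_family) net"
    and \<eta>1 :: "('i, 'x::archimedean_riesz_space) net_conv"
    and \<eta>2 :: "('i, 'y::archimedean_riesz_space) net_conv"
    and \<eta>3 :: "('i, 'z::archimedean_riesz_space) net_conv"
    and pr :: "'x \<Rightarrow> 'y \<Rightarrow> 'z"
    and \<mu> :: "'w set \<Rightarrow> 'y"
  assumes "partially_ordered_integration_structure \<Omega> \<H> \<NN> \<eta>1 \<eta>2 \<eta>3 pr"
  shows "(\<forall>f\<in>L_NR \<H> \<NN> \<eta>3 pr \<mu>. (\<forall>\<omega>\<in>\<Omega>. 0 \<le> f \<omega>) \<longrightarrow> (\<forall>B\<in>\<H>. 0 \<le> \<mu> B) \<longrightarrow>
      (\<forall>A\<in>\<H>. 0 \<le> net_riemann_integral \<NN> \<eta>3 pr \<mu> f A)) \<and>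
    ((\<forall>B\<in>\<H>. 0 \<le> \<mu> B) \<longrightarrow>
      (\<forall>f\<in>L_NR \<H> \<NN> \<eta>3 pr \<mu>. \<forall>g\<in>L_NR \<H> \<NN> \<eta>3 pr \<mu>. (\<forall>\<omega>\<in>\<Omega>. f \<omega> \<le> g \<omega>) \<longrightarrow>
        (\<forall>A\<in>\<H>. net_riemann_integral \<NN> \<eta>3 pr \<mu> f A \<le> net_riemann_integral \<NN> \<eta>3 pr \<mu> g A))) \<and>
    ((\<forall>B\<in>\<H>. 0 \<le> \<mu> B) \<longrightarrow>
      (\<forall>f\<in>L_NR \<H> \<NN> \<eta>3 pr \<mu>. (\<lambda>\<omega>. \<bar>f \<omega>\<bar>) \<in> L_NR \<H> \<NN> \<eta>3 pr \<mu> \<longrightarrow>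
        (\<forall>A\<in>\<H>. \<bar>net_riemann_integral \<NN> \<eta>3 pr \<mu> f A\<bar>
          \<le> net_riemann_integral \<NN> \<eta>3 pr \<mu> (\<lambda>\<omega>. \<bar>f \<omega>\<bar>) A)))"
proof -
  interpret partially_ordered_integration_structure \<Omega> \<H> \<NN> \<eta>1 \<eta>2 \<eta>3 pr
    by (rule assms)
  show ?thesis
    by (intro conjI ballI impI) (rule integral_nonneg integral_mono abs_integral_le; assumption)+
qed

end
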